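(* Let $(X,A)$, $(Y,B)$, $(Z,C)$, $(W,D)$ be CW pairs, and let $f\colon (X,A)\to (Y,B)$ and $g\colon (Z,C)\to (W,D)$ be maps of pairs such that $X\times Z$ is a normal space. Then, for the map of pairs $$f\times g\colon (X\times Z,\ X\times C\cup A\times Z)\to (Y\times W,\ Y\times D\cup B\times W),$$ one has $\operatorname{relcat}(f\times g)\le \operatorname{relcat}(f)+\operatorname{relcat}(g)$.
   Context: All maps are continuous and $I=[0,1]$. A map is inessential if it is homotopic to a constant map. Relative category of a map: for a map of pairs $f\colon (X,A)\to (Y,B)$, $\operatorname{relcat}(f)$ is the least non-negative integer $n$ such that $X$ can be covered by open sets $V_0,V_1,\dots,V_n$ with $A\subseteq V_0$ such that (a) for $1\le i\le n$ the restriction $f|_{V_i}\colon V_i\to Y$ is inessential, and (b) there is a homotopy of pairs $H\colon (V_0\times I, A\times I)\to (Y,B)$ with $H(-,1)=f|_{V_0}$ and $H(V_0,0)\subseteq B$. If no such $n$ exists, $\operatorname{relcat}(f)=\infty$.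
   Formalization: Added hypothesis: f(X) lies in one path component of Y and g(Z) in one of W (automatic for path-connected spaces). Without it the claim fails: for identities of the discrete pair ({0,1,2,3},{0}), relcat of each is 3, but relcat of the product is 9 > 6. *)

theory Defs
  imports "HOL-Analysis.Analysis"
begin

definition unit_disc :: "nat \<Rightarrow> (nat \<Rightarrow> real) topology" where
  "unit_disc n = subtopology (Euclidean_space n) {x. (\<Sum>i<n. (x i)\<^sup>2) \<le> 1}"

definition open_unit_disc :: "nat \<Rightarrow> (nat \<Rightarrow> real) set" where
  "open_unit_disc n = {x \<in> topspace (Euclidean_space n). (\<Sum>i<n. (x i)\<^sup>2) < 1}"

definition unit_disc_boundary :: "nat \<Rightarrow> (nat \<Rightarrow> real) set" where
  "unit_disc_boundary n = {x \<in> topspace (Euclidean_space n). (\<Sum>i<n. (x i)\<^sup>2) = 1}"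

text \<open>
  Whitehead's definition of a CW complex: \<open>E n\<close> is the set of open \<open>n\<close>-cells (as subsets of the
  space). Closure-finiteness is the requirement that the boundary of a cell is attached along
  finitely many cells of lower dimension; the last conjunct is the weak topology.
\<close>

definition characteristic_map ::
    "'a topology \<Rightarrow> (nat \<Rightarrow> 'a set set) \<Rightarrow> nat \<Rightarrow> 'a set \<Rightarrow> ((nat \<Rightarrow> real) \<Rightarrow> 'a) \<Rightarrow> bool" where
  "characteristic_map X E n e \<Phi> \<longleftrightarrow>
     continuous_map (unit_disc n) X \<Phi> \<and>
     homeomorphic_map (subtopology (unit_disc n) (open_unit_disc n)) (subtopology X e) \<Phi> \<and>
     (\<exists>F. finite F \<and> F \<subseteq> (\<Union>m<n. E m) \<and> \<Phi> ` unit_disc_boundary n \<subseteq> \<Union>F)"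

definition cw_complex :: "'a topology \<Rightarrow> (nat \<Rightarrow> 'a set set) \<Rightarrow> bool" where
  "cw_complex X E \<longleftrightarrow>
     Hausdorff_space X \<and>
     (\<Union>n. \<Union>(E n)) = topspace X \<and>
     (\<forall>m n. \<forall>e\<in>E m. \<forall>e'\<in>E n. e \<inter> e' \<noteq> {} \<longrightarrow> m = n \<and> e = e') \<and>
     (\<forall>n. \<forall>e\<in>E n. \<exists>\<Phi>. characteristic_map X E n e \<Phi>) \<and>
     (\<forall>S. S \<subseteq> topspace X \<and> (\<forall>n. \<forall>e\<in>E n. closedin X (S \<inter> X closure_of e)) \<longrightarrow> closedin X S)"

definition cw_subcomplex :: "'a topology \<Rightarrow> (nat \<Rightarrow> 'a set set) \<Rightarrow> 'a set \<Rightarrow> bool" where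
  "cw_subcomplex X E A \<longleftrightarrow>
     (\<exists>F. F \<subseteq> (\<Union>n. E n) \<and> A = \<Union>F \<and> (\<forall>e\<in>F. X closure_of e \<subseteq> A))"

definition cw_pair :: "'a topology \<Rightarrow> 'a set \<Rightarrow> bool" where
  "cw_pair X A \<longleftrightarrow> (\<exists>E. cw_complex X E \<and> cw_subcomplex X E A)"

definition pair_map :: "'a topology \<Rightarrow> 'a set \<Rightarrow> 'b topology \<Rightarrow> 'b set \<Rightarrow> ('a \<Rightarrow> 'b) \<Rightarrow> bool" where
  "pair_map X A Y B f \<longleftrightarrow> continuous_map X Y f \<and> f ` A \<subseteq> B"

definition inessential :: "'a topology \<Rightarrow> 'b topology \<Rightarrow> ('a \<Rightarrow> 'b) \<Rightarrow> bool" where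
  "inessential X Y f \<longleftrightarrow> (\<exists>c. homotopic_with (\<lambda>_. True) X Y f (\<lambda>_. c))"

definition relcat_cover ::
    "'a topology \<Rightarrow> 'a set \<Rightarrow> 'b topology \<Rightarrow> 'b set \<Rightarrow> ('a \<Rightarrow> 'b) \<Rightarrow> nat \<Rightarrow> (nat \<Rightarrow> 'a set) \<Rightarrow> bool" where
  "relcat_cover X A Y B f n V \<longleftrightarrow>
     (\<forall>i\<le>n. openin X (V i)) \<and> (\<Union>i\<le>n. V i) = topspace X \<and> A \<subseteq> V 0 \<and>
     (\<forall>i\<in>{1..n}. inessential (subtopology X (V i)) Y f) \<and>
     (\<exists>H. pair_map (prod_topology (subtopology X (V 0)) (top_of_set {0..1::real}))
                   (A \<times> {0..1}) Y B H \<and>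
          (\<forall>x\<in>V 0. H (x, 1) = f x \<and> H (x, 0) \<in> B))"

definition relcat ::
    "'a topology \<Rightarrow> 'a set \<Rightarrow> 'b topology \<Rightarrow> 'b set \<Rightarrow> ('a \<Rightarrow> 'b) \<Rightarrow> enat" where
  "relcat X A Y B f =
     (if \<exists>n V. relcat_cover X A Y B f n V
      then enat (LEAST n. \<exists>V. relcat_cover X A Y B f n V) else \<infinity>)"

text \<open>
  Category theory of maps conventionally works with path-connected spaces. Some such convention
  is needed for product inequalities: finitely many disjoint open sets on which a map is
  inessential can be merged into one only if the resulting constants lie in the same path
  component. The condition below holds whenever \<open>X\<close> or \<open>Y\<close> is path-connected.
\<close>

definition image_in_path_component :: "'a topology \<Rightarrow> 'b topology \<Rightarrow> ('a \<Rightarrow> 'b) \<Rightarrow> bool" where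
  "image_in_path_component X Y f \<longleftrightarrow>
     (\<forall>x\<in>topspace X. \<forall>x'\<in>topspace X. path_component_of Y (f x) (f x'))"

end

theory Submission
  imports Defs
begin

text \<open>
  By normality the two covers are refined by the positivity sets of functions \<open>a\<^sub>i\<close> and \<open>b\<^sub>j\<close>.
  On \<open>{a\<^sub>0 > 0} \<union> {b\<^sub>0 > 0}\<close> both given deformations can be run at once, each slowed down where
  its own weight is the smaller one: at every point the one with the larger weight runs to the end,
  so the product ends in \<open>Y \<times> D \<union> B \<times> W\<close>. The rest of \<open>X \<times> Z\<close> is covered, for each \<open>k\<close>, by
  disjoint open sets on which the map factors through \<open>V\<^sub>i \<times> U\<^sub>j\<close> with \<open>i + j = k\<close> and \<open>i, j \<ge> 1\<close>;
  their nullhomotopies can be moved to a common constant and glued.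
\<close>

section \<open>CW complexes: subcomplexes are closed\<close>

text \<open>\<open>Euclidean_space n\<close> sits in the countable power of the real line as the
  sequences vanishing from index n on, so the disc is a closed subset of the cube
  \<open>PiE UNIV (\<lambda>i. {-1..1})\<close>, which is compact by Tychonoff.\<close>

lemma compact_space_unit_disc: "compact_space (unit_disc n)"
proof -
  let ?D = "{x. \<forall>i\<ge>n. x i = 0} \<inter> {x::nat \<Rightarrow> real. (\<Sum>i<n. (x i)\<^sup>2) \<le> 1}"
  have bnd: "\<bar>x i\<bar> \<le> 1" if "x \<in> ?D" for x i
  proof (cases "i < n")
    case True
    then have "(x i)\<^sup>2 \<le> (\<Sum>i<n. (x i)\<^sup>2)"
      by (intro member_le_sum) auto
    also have "\<dots> \<le> 1"
      using that by simp
    finally show ?thesis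
      by (simp add: abs_square_le_1)
  qed (use that in auto)
  have "compactin (powertop_real UNIV) (PiE UNIV (\<lambda>i. {-1..1}))"
    by (subst compactin_PiE) auto
  moreover have "?D \<subseteq> PiE UNIV (\<lambda>i. {-1..1})"
    using bnd by (fastforce simp: abs_le_iff)
  moreover have "closedin (powertop_real UNIV) ?D"
  proof (rule closedin_Int)
    show "closedin (powertop_real UNIV) {x. \<forall>i\<ge>n. x i = 0}"
      using closedin_Euclidean_space[of n] by (simp add: topspace_Euclidean_space)
    have "continuous_map (powertop_real UNIV) euclideanreal (\<lambda>x. \<Sum>i<n. (x i)\<^sup>2)"
      by (intro continuous_intros continuous_map_product_projection) auto
    from closedin_continuous_map_preimage[OF this, of "{..1}"]
    show "closedin (powertop_real UNIV) {x. (\<Sum>i<n. (x i)\<^sup>2) \<le> 1}"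
      by simp
  qed
  ultimately have "compactin (powertop_real UNIV) ?D"
    by (rule closed_compactin)
  moreover have "unit_disc n = subtopology (powertop_real UNIV) ?D"
    by (simp add: unit_disc_def Euclidean_space_def subtopology_subtopology)
  ultimately show ?thesis
    by (simp add: compact_space_subtopology)
qed

text \<open>The image of the disc under a characteristic map is compact, hence closed in the
  Hausdorff space, so it contains the closure of the cell. It consists of the cell itself and the
  image of the boundary sphere, which closure-finiteness places in finitely many cells.\<close>

lemma cw_complex_closure_of_cell:
  assumes cw: "cw_complex X E" and e: "e \<in> E n"
  obtains F where "finite F" "F \<subseteq> (\<Union>m. E m)" "X closure_of e \<subseteq> \<Union>F"
proof -
  obtain \<Phi> where \<Phi>: "continuous_map (unit_disc n) X \<Phi>"
      "homeomorphic_map (subtopology (unit_disc n) (open_unit_disc n)) (subtopology X e) \<Phi>"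
    and "\<exists>F. finite F \<and> F \<subseteq> (\<Union>m<n. E m) \<and> \<Phi> ` unit_disc_boundary n \<subseteq> \<Union>F"
    using cw e unfolding cw_complex_def characteristic_map_def by meson
  then obtain F where F: "finite F" "F \<subseteq> (\<Union>m<n. E m)" "\<Phi> ` unit_disc_boundary n \<subseteq> \<Union>F"
    by blast
  have "Hausdorff_space X"
    using cw unfolding cw_complex_def by (elim conjE)
  have "(\<Union>n. \<Union>(E n)) = topspace X"
    using cw unfolding cw_complex_def by (elim conjE)
  then have eX: "e \<subseteq> topspace X"
    using e by blast
  have "open_unit_disc n \<subseteq> topspace (unit_disc n)"
    by (auto simp: open_unit_disc_def unit_disc_def)
  then have im: "\<Phi> ` open_unit_disc n = e"
    using homeomorphic_imp_surjective_map[OF \<Phi>(2)] eX by (simp add: Int_absorb1 Int_absorb2)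
  have disc: "topspace (unit_disc n) = open_unit_disc n \<union> unit_disc_boundary n"
    by (auto simp: open_unit_disc_def unit_disc_def unit_disc_boundary_def)
  have "compactin X (\<Phi> ` topspace (unit_disc n))"
    using image_compactin[OF _ \<Phi>(1)] compact_space_unit_disc compact_space_def by blast
  then have "closedin X (\<Phi> ` topspace (unit_disc n))"
    using \<open>Hausdorff_space X\<close> compactin_imp_closedin by blast
  then have "X closure_of e \<subseteq> \<Phi> ` topspace (unit_disc n)"
    using im disc by (intro closure_of_minimal) auto
  also have "\<dots> \<subseteq> \<Union>(insert e F)"
    using F(3) im disc by auto
  finally show thesis
    using F(1,2) e by (intro that[of "insert e F"]) blast+
qed

lemma cw_pair_Hausdorff_space: "cw_pair X A \<Longrightarrow> Hausdorff_space X"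
  unfolding cw_pair_def cw_complex_def by (elim exE conjE)

text \<open>By the weak topology it is enough to test A against the closure of each cell. That
  closure lies in a finite union of cells; since cells are disjoint, only those in
  \<open>F \<inter> G\<close> contribute to A, and their closures stay in A. So the trace of A is a
  finite union of closed sets cut with a closed set.\<close>

lemma cw_pair_closedin:
  assumes "cw_pair X A"
  shows "closedin X A"
proof -
  obtain E F where cw: "cw_complex X E" and F: "F \<subseteq> (\<Union>n. E n)" "A = \<Union>F"
    and clF: "\<And>e. e \<in> F \<Longrightarrow> X closure_of e \<subseteq> A"
    using assms unfolding cw_pair_def cw_subcomplex_def by blast
  have disj: "e = e'" if "e \<in> E m" "e' \<in> E n" "e \<inter> e' \<noteq> {}" for e e' m n
    using cw that unfolding cw_complex_def by blast
  have top: "(\<Union>n. \<Union>(E n)) = topspace X"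
    using cw unfolding cw_complex_def by (elim conjE)
  have AX: "A \<subseteq> topspace X"
    using F top by blast
  have "closedin X (A \<inter> X closure_of e)" if e: "e \<in> E n" for e n
  proof -
    obtain G where G: "finite G" "G \<subseteq> (\<Union>m. E m)" "X closure_of e \<subseteq> \<Union>G"
      using cw_complex_closure_of_cell[OF cw e] .
    have "A \<inter> X closure_of e = (\<Union>d\<in>F \<inter> G. X closure_of d) \<inter> X closure_of e"
    proof (intro equalityI subsetI)
      fix x assume x: "x \<in> A \<inter> X closure_of e"
      then have "x \<in> \<Union>F" "x \<in> \<Union>G"
        using F(2) G(3) by auto
      then obtain d d' where d: "d \<in> F" "x \<in> d" "d' \<in> G" "x \<in> d'"
        by (elim UnionE)
      from d obtain k l where kl: "d \<in> E k" "d' \<in> E l"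
        using F(1) G(2) by (meson UN_E subsetD)
      have "d = d'"
        using disj[OF kl] d by auto
      moreover have "d \<subseteq> X closure_of d"
        using d(1) F(2) AX by (intro closure_of_subset) auto
      ultimately have "d \<in> F \<inter> G" "x \<in> X closure_of d"
        using d by auto
      then show "x \<in> (\<Union>d\<in>F \<inter> G. X closure_of d) \<inter> X closure_of e"
        using x by auto
    next
      fix x assume "x \<in> (\<Union>d\<in>F \<inter> G. X closure_of d) \<inter> X closure_of e"
      then show "x \<in> A \<inter> X closure_of e"
        using clF by (auto dest: subsetD)
    qed
    moreover have "closedin X (\<Union>d\<in>F \<inter> G. X closure_of d)"
      using G(1) by (intro closedin_Union) auto
    ultimately show ?thesis
      by (simp add: closedin_Int)
  qed
  moreover have "\<forall>S. S \<subseteq> topspace X \<and> (\<forall>n. \<forall>e\<in>E n. closedin X (S \<inter> X closure_of e))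
      \<longrightarrow> closedin X S"
    using cw unfolding cw_complex_def by (elim conjE)
  ultimately show ?thesis
    using AX by (elim allE[of _ A]) simp
qed

section \<open>Normality: passage to the factors and shrinking of covers by functions\<close>

text \<open>Each factor is homeomorphic to a slice through a point of the other. Points are closed
  in a Hausdorff space, so the slice is closed and inherits normality.\<close>

lemma normal_space_prod_topology_factors:
  assumes "normal_space (prod_topology X Z)" "Hausdorff_space X" "Hausdorff_space Z"
    and "topspace X \<noteq> {}" "topspace Z \<noteq> {}"
  shows "normal_space X" "normal_space Z"
proof -
  obtain x z where x: "x \<in> topspace X" and z: "z \<in> topspace Z"
    using assms by blast
  have "closedin (prod_topology X Z) (topspace X \<times> {z})"
    using assms z by (auto simp: closedin_prod_Times_iff Hausdorff_imp_t1_space closedin_t1_singleton)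
  then have "normal_space (prod_topology X (subtopology Z {z}))"
    using assms(1) normal_space_closed_subtopology by (simp add: prod_topology_subtopology)
  then show "normal_space X"
    using homeomorphic_space_prod_topology_sing1[OF z] homeomorphic_normal_space by blast
  have "closedin (prod_topology X Z) ({x} \<times> topspace Z)"
    using assms x by (auto simp: closedin_prod_Times_iff Hausdorff_imp_t1_space closedin_t1_singleton)
  then have "normal_space (prod_topology (subtopology X {x}) Z)"
    using assms(1) normal_space_closed_subtopology by (simp add: prod_topology_subtopology)
  then show "normal_space Z"
    using homeomorphic_space_prod_topology_sing2[OF x] homeomorphic_normal_space by blast
qed

lemma normal_space_Urysohn_open:
  assumes "normal_space X" "closedin X S" "openin X U" "S \<subseteq> U"
  obtains u :: "'a \<Rightarrow> real" where "continuous_map X euclideanreal u"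
    "\<And>x. x \<in> topspace X \<Longrightarrow> 0 \<le> u x" "\<And>x. x \<in> topspace X \<Longrightarrow> 0 < u x \<Longrightarrow> x \<in> U"
    "\<And>x. x \<in> S \<Longrightarrow> 0 < u x"
proof -
  obtain u where u: "continuous_map X (top_of_set {0..1::real}) u"
      "u ` (topspace X - U) \<subseteq> {0}" "u ` S \<subseteq> {1}"
  proof (rule Urysohn_lemma[where a = "0::real" and b = 1])
    show "normal_space X" "closedin X (topspace X - U)" "closedin X S"
      using assms by auto
    show "disjnt (topspace X - U) S"
      using assms(4) by (auto simp: disjnt_def)
  qed auto
  show thesis
  proof (rule that[of u])
    show "continuous_map X euclideanreal u" "\<And>x. x \<in> topspace X \<Longrightarrow> 0 \<le> u x"
      using u(1) by (auto simp: continuous_map_in_subtopology)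
    show "x \<in> U" if "x \<in> topspace X" "0 < u x" for x
      using u(2) that by fastforce
    show "0 < u x" if "x \<in> S" for x
      using u(3) that by fastforce
  qed
qed

text \<open>A shrinking lemma in terms of functions, by peeling off the last set: a Urysohn function
  takes care of what only that set covers, and the induction hypothesis is applied to the closed
  rest of S. This is why S varies in the induction.\<close>

lemma normal_space_cover_functions:
  fixes V :: "nat \<Rightarrow> 'a set"
  assumes "normal_space X" "closedin X S" "\<And>i. i < n \<Longrightarrow> openin X (V i)" "S \<subseteq> (\<Union>i<n. V i)"
  shows "\<exists>a :: nat \<Rightarrow> 'a \<Rightarrow> real. (\<forall>i<n. continuous_map X euclideanreal (a i) \<and>
           (\<forall>x\<in>topspace X. 0 \<le> a i x \<and> (0 < a i x \<longrightarrow> x \<in> V i))) \<and> (\<forall>x\<in>S. \<exists>i<n. 0 < a i x)"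
  using assms(2-)
proof (induction n arbitrary: S)
  case 0
  then show ?case by auto
next
  case (Suc n)
  let ?T = "S - (\<Union>i<n. V i)"
  have "closedin X ?T"
    using Suc.prems by (intro closedin_diff openin_Union) auto
  moreover have "?T \<subseteq> V n"
    using Suc.prems(3) by (fastforce simp: less_Suc_eq)
  ultimately obtain u :: "'a \<Rightarrow> real" where u: "continuous_map X euclideanreal u"
    "\<And>x. x \<in> topspace X \<Longrightarrow> 0 \<le> u x" "\<And>x. x \<in> topspace X \<Longrightarrow> 0 < u x \<Longrightarrow> x \<in> V n"
    "\<And>x. x \<in> ?T \<Longrightarrow> 0 < u x"
    using normal_space_Urysohn_open[OF assms(1), of ?T "V n"] Suc.prems(2)[of n] by blast
  \<comment> \<open>Where \<open>u\<close> is positive nothing is left to do. The rest of S is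
    closed and avoids \<open>?T\<close>, so the first n sets cover it.\<close>
  let ?S = "S \<inter> {x \<in> topspace X. u x \<in> {..0}}"
  have "closedin X ?S"
    using Suc.prems(1) closedin_continuous_map_preimage[OF u(1), of "{..0}"] by auto
  moreover have "?S \<subseteq> (\<Union>i<n. V i)"
    using u(4) by fastforce
  ultimately obtain a :: "nat \<Rightarrow> 'a \<Rightarrow> real" where
    a: "\<forall>i<n. continuous_map X euclideanreal (a i) \<and>
         (\<forall>x\<in>topspace X. 0 \<le> a i x \<and> (0 < a i x \<longrightarrow> x \<in> V i))" "\<forall>x\<in>?S. \<exists>i<n. 0 < a i x"
    using Suc.IH[of ?S] Suc.prems(2)[OF less_SucI] by blast
  have "\<exists>i<Suc n. 0 < (a(n := u)) i x" if "x \<in> S" for x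
  proof (cases "0 < u x")
    case False
    then have "x \<in> ?S"
      using that Suc.prems(1) closedin_subset by fastforce
    then obtain i where "i < n" "0 < a i x"
      using a(2) by blast
    then show ?thesis
      by (intro exI[of _ i]) auto
  qed auto
  then show ?case
    using a(1) u(1-3) by (intro exI[of _ "a(n := u)"]) (auto simp: less_Suc_eq)
qed

section \<open>Nullhomotopies: pasting and moving the constant\<close>

text \<open>Disjointness leaves no overlap on which the separately chosen homotopies could disagree,
  and openness makes the pasted map continuous. In the application \<open>g\<close> is one constant
  map shared by all pieces.\<close>

lemma homotopic_with_const_disjoint_Union:
  assumes ope: "\<And>i. i \<in> I \<Longrightarrow> openin X (N i)"
    and disj: "\<And>i j. i \<in> I \<Longrightarrow> j \<in> I \<Longrightarrow> i \<noteq> j \<Longrightarrow> N i \<inter> N j = {}"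
    and hom: "\<And>i. i \<in> I \<Longrightarrow> homotopic_with (\<lambda>_. True) (subtopology X (N i)) Y f g"
  shows "homotopic_with (\<lambda>_. True) (subtopology X (\<Union>i\<in>I. N i)) Y f g"
proof -
  let ?U = "\<Union>i\<in>I. N i" and ?J = "top_of_set {0..1::real}"
  have "\<forall>i\<in>I. \<exists>h. continuous_map (prod_topology ?J (subtopology X (N i))) Y h \<and>
      (\<forall>x. h (0, x) = f x) \<and> (\<forall>x. h (1, x) = g x)"
    using hom unfolding homotopic_with_def by blast
  then obtain h where h: "\<And>i. i \<in> I \<Longrightarrow> continuous_map (prod_topology ?J (subtopology X (N i))) Y (h i)"
    "\<And>i x. i \<in> I \<Longrightarrow> h i (0, x) = f x" "\<And>i x. i \<in> I \<Longrightarrow> h i (1, x) = g x"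
    by metis
  define k where "k = (\<lambda>x. SOME i. i \<in> I \<and> x \<in> N i)"
  have k: "k x = i" if "i \<in> I" "x \<in> N i" for x i
  proof -
    have "k x \<in> I \<and> x \<in> N (k x)"
      unfolding k_def using that by (intro someI) blast
    then show ?thesis
      using disj that by blast
  qed
  define G where "G = (\<lambda>(t::real, x). h (k x) (t, x))"
  have cont: "continuous_map (prod_topology ?J (subtopology X ?U)) Y G"
  proof (rule pasting_lemma[where I = I and T = "\<lambda>i. {0..1} \<times> N i" and f = h])
    fix i assume i: "i \<in> I"
    show "openin (prod_topology ?J (subtopology X ?U)) ({0..1} \<times> N i)"
    proof -
      have "openin X ?U"
        using ope by blast
      then have "openin (subtopology X ?U) (N i)"
        using ope[OF i] i by (auto simp: openin_open_subtopology)
      then show ?thesis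
        by (simp add: openin_prod_Times_iff)
    qed
    have "subtopology (prod_topology ?J (subtopology X ?U)) ({0..1} \<times> N i)
        = prod_topology ?J (subtopology X (N i))"
    proof -
      have "?U \<inter> N i = N i"
        using i by blast
      then show ?thesis
        by (simp add: subtopology_Times subtopology_subtopology)
    qed
    then show "continuous_map (subtopology (prod_topology ?J (subtopology X ?U)) ({0..1} \<times> N i)) Y (h i)"
      using h(1)[OF i] by simp
  next
    fix i j z
    assume "i \<in> I" "j \<in> I"
      "z \<in> topspace (prod_topology ?J (subtopology X ?U)) \<inter> ({0..1} \<times> N i) \<inter> ({0..1} \<times> N j)"
    then show "h i z = h j z"
      using k[of i "snd z"] k[of j "snd z"] by auto
  next
    fix z assume "z \<in> topspace (prod_topology ?J (subtopology X ?U))"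
    then show "\<exists>j. j \<in> I \<and> z \<in> {0..1} \<times> N j \<and> G z = h j z"
      using k by (fastforce simp: G_def)
  qed
  have "\<forall>x\<in>?U. G (0, x) = f x \<and> G (1, x) = g x"
    using k h by (auto simp: G_def)
  then show ?thesis
    using cont by (subst homotopic_with) (auto intro!: exI[of _ G])
qed

text \<open>The track of any point x of V joins \<open>f x\<close> to the constant of the given
  nullhomotopy, and \<open>f x\<close> can be joined to \<open>f x0\<close> in Y, so the constant
  can be moved along a path to \<open>f x0\<close>. This gives all nullhomotopies one common
  end.\<close>

lemma inessential_homotopic_const:
  assumes "inessential (subtopology X V) Y f" "image_in_path_component X Y f" "x0 \<in> topspace X"
  shows "homotopic_with (\<lambda>_. True) (subtopology X V) Y f (\<lambda>_. f x0)"
proof -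
  obtain c where c: "homotopic_with (\<lambda>_. True) (subtopology X V) Y f (\<lambda>_. c)"
    using assms(1) unfolding inessential_def by blast
  have "homotopic_with (\<lambda>_. True) (subtopology X V) Y (\<lambda>_. c) (\<lambda>_. f x0)"
  \<comment> \<open>An empty V offers no point to follow, but any two constant maps on the empty
    space are homotopic.\<close>
  proof (cases "topspace (subtopology X V) = {}")
    case True
    then have "subtopology X V = trivial_topology"
      using null_topspace_iff_trivial by blast
    then show ?thesis
      by (simp add: homotopic_constant_maps)
  next
    case False
    then obtain x where x: "x \<in> topspace X" "x \<in> V" by auto
    \<comment> \<open>On the one-point subspace f is constant, so the restricted homotopy amounts to
      a path from \<open>f x\<close> to \<open>c\<close>.\<close>
    have "homotopic_with (\<lambda>_. True) (subtopology (subtopology X V) {x}) Y f (\<lambda>_. c)"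
      using c by (rule homotopic_from_subtopology)
    then have "homotopic_with (\<lambda>_. True) (subtopology (subtopology X V) {x}) Y (\<lambda>_. f x) (\<lambda>_. c)"
      by (rule homotopic_with_eq) auto
    moreover have "subtopology (subtopology X V) {x} \<noteq> trivial_topology"
      using x by (metis IntI empty_iff insertI1 topspace_discrete_topology topspace_subtopology)
    ultimately have "path_component_of Y (f x) c"
      by (simp add: homotopic_constant_maps)
    moreover have "path_component_of Y (f x) (f x0)"
      using assms x unfolding image_in_path_component_def by blast
    ultimately have "path_component_of Y c (f x0)"
      by (meson path_component_of_sym path_component_of_trans)
    then show ?thesis
      by (simp add: homotopic_constant_maps)
  qed
  with c show ?thesis
    by (rule homotopic_with_trans)
qed


section \<open>Deformation of one factor, slowed down by weights\<close>

lemma weighted_deformation: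
  fixes \<alpha> \<beta> :: "'q \<Rightarrow> real"
  assumes f: "pair_map X A Y B f"
    and H: "continuous_map (prod_topology (subtopology X V) (top_of_set {0..1::real})) Y H"
      "H ` (A \<times> {0..1}) \<subseteq> B" "\<And>x. x \<in> V \<Longrightarrow> H (x, 1) = f x" "\<And>x. x \<in> V \<Longrightarrow> H (x, 0) \<in> B"
    and p: "continuous_map T X p"
    and \<alpha>: "continuous_map T euclideanreal \<alpha>" "\<And>q. q \<in> topspace T \<Longrightarrow> 0 \<le> \<alpha> q"
      "\<And>q. q \<in> topspace T \<Longrightarrow> 0 < \<alpha> q \<Longrightarrow> p q \<in> V"
    and \<beta>: "continuous_map T euclideanreal \<beta>" "\<And>q. q \<in> topspace T \<Longrightarrow> 0 \<le> \<beta> q"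
    and pos: "\<And>q. q \<in> topspace T \<Longrightarrow> 0 < \<alpha> q + \<beta> q"
  obtains G where "continuous_map (prod_topology T (top_of_set {0..1::real})) Y G"
    "\<And>q. q \<in> topspace T \<Longrightarrow> G (q, 1) = f (p q)"
    "\<And>q. q \<in> topspace T \<Longrightarrow> \<beta> q \<le> \<alpha> q \<Longrightarrow> G (q, 0) \<in> B"
    "\<And>q t. q \<in> topspace T \<Longrightarrow> p q \<in> A \<Longrightarrow> t \<in> {0..1} \<Longrightarrow> G (q, t) \<in> B"
proof -
  let ?I = "top_of_set {0..1::real}"
  let ?P = "prod_topology T ?I"
  \<comment> \<open>\<open>\<sigma> q\<close> is the time at which H is stopped on its way from 1
    down to 0. It is 0 for \<open>\<beta> q \<le> \<alpha> q\<close> and has risen to 1 when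
    \<open>3 * \<alpha> q = \<beta> q\<close>, where \<open>\<alpha> q\<close> is still
    positive.\<close>
  define \<sigma> where "\<sigma> = (\<lambda>q. max 0 (min 1 (2 * (\<beta> q - \<alpha> q) / (\<alpha> q + \<beta> q))))"
  have \<sigma>01: "0 \<le> \<sigma> q" "\<sigma> q \<le> 1" for q
    by (auto simp: \<sigma>_def)
  have \<sigma>0: "\<sigma> q = 0" if "q \<in> topspace T" "\<beta> q \<le> \<alpha> q" for q
  proof -
    have "2 * (\<beta> q - \<alpha> q) / (\<alpha> q + \<beta> q) \<le> 0"
      using pos[OF that(1)] that(2) by (intro divide_nonpos_pos) auto
    then show ?thesis
      by (simp add: \<sigma>_def)
  qed
  have \<sigma>1: "\<sigma> q = 1" if "q \<in> topspace T" "3 * \<alpha> q = \<beta> q" for q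
    using pos[OF that(1)] that(2)[symmetric] by (simp add: \<sigma>_def)
  have cont\<sigma>: "continuous_map T euclideanreal \<sigma>"
    unfolding \<sigma>_def using pos by (intro continuous_intros \<alpha> \<beta>) force+
  \<comment> \<open>As t goes from 0 to 1 this moves affinely from \<open>\<sigma> q\<close> to 1,
    so every track ends at f.\<close>
  define r where "r = (\<lambda>z. 1 - (1 - snd z) * (1 - \<sigma> (fst z)))"
  have r01: "r (q, t) \<in> {0..1}" if "t \<in> {0..1}" for q t
  proof -
    have "(1 - t) * (1 - \<sigma> q) \<le> 1 * 1" "0 \<le> (1 - t) * (1 - \<sigma> q)"
      using that \<sigma>01[of q] by (intro mult_mono mult_nonneg_nonneg; simp)+
    then show ?thesis
      by (simp add: r_def)
  qed
  \<comment> \<open>The branches agree where \<open>3 * \<alpha> q = \<beta> q\<close>, since r is 1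
    there. Since the sum of the weights is positive, \<open>\<beta> q \<le> 3 * \<alpha> q\<close>
    forces \<open>0 < \<alpha> q\<close>, which keeps the second branch inside V.\<close>
  define G where "G = (\<lambda>z. if 3 * \<alpha> (fst z) \<le> \<beta> (fst z) then f (p (fst z)) else H (p (fst z), r z))"
  have fst: "continuous_map ?P T fst" and snd: "continuous_map ?P euclideanreal snd"
    using continuous_map_into_fulltopology[OF continuous_map_snd[of T ?I]]
    by (auto simp: continuous_map_fst)
  have contr: "continuous_map ?P euclideanreal r"
    unfolding r_def
    using snd continuous_map_compose[OF fst cont\<sigma>] by (intro continuous_intros) (auto simp: o_def)
  have contG: "continuous_map ?P Y G"
    unfolding G_def
  proof (rule continuous_map_cases_le)
    show "continuous_map ?P euclideanreal (\<lambda>z. 3 * \<alpha> (fst z))"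
      "continuous_map ?P euclideanreal (\<lambda>z. \<beta> (fst z))"
      using continuous_map_compose[OF fst \<alpha>(1)] continuous_map_compose[OF fst \<beta>(1)]
      by (auto simp: o_def intro!: continuous_intros)
    have "continuous_map ?P Y (f \<circ> p \<circ> fst)"
      using f fst p by (auto simp: pair_map_def intro: continuous_map_compose)
    then show "continuous_map (subtopology ?P {z \<in> topspace ?P. 3 * \<alpha> (fst z) \<le> \<beta> (fst z)}) Y
        (\<lambda>z. f (p (fst z)))"
      by (auto simp: o_def intro: continuous_map_from_subtopology)
    let ?S = "subtopology ?P {z \<in> topspace ?P. \<beta> (fst z) \<le> 3 * \<alpha> (fst z)}"
    have "p (fst z) \<in> V" if "z \<in> topspace ?S" for z
    proof -
      have "fst z \<in> topspace T" "\<beta> (fst z) \<le> 3 * \<alpha> (fst z)"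
        using that by auto
      then show ?thesis
        using pos[of "fst z"] \<alpha>(3) by force
    qed
    moreover have "continuous_map ?S X (\<lambda>z. p (fst z))"
      using continuous_map_compose[OF fst p] by (auto simp: o_def intro: continuous_map_from_subtopology)
    ultimately have "continuous_map ?S (subtopology X V) (\<lambda>z. p (fst z))"
      by (auto simp: continuous_map_in_subtopology)
    moreover have "r z \<in> {0..1}" if "z \<in> topspace ?S" for z
      using r01[of "snd z" "fst z"] that by auto
    then have "continuous_map ?S ?I r"
      using continuous_map_from_subtopology[OF contr] by (auto simp: continuous_map_in_subtopology)
    ultimately have "continuous_map ?S (prod_topology (subtopology X V) ?I) (\<lambda>z. (p (fst z), r z))"
      by (simp add: continuous_map_paired)
    from continuous_map_compose[OF this H(1)]
    show "continuous_map ?S Y (\<lambda>z. H (p (fst z), r z))"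
      by (simp add: o_def)
    fix z assume z: "z \<in> topspace ?P" "3 * \<alpha> (fst z) = \<beta> (fst z)"
    then have q: "fst z \<in> topspace T"
      by auto
    then have "0 < \<alpha> (fst z)"
      using pos[of "fst z"] z(2) by simp
    then have "p (fst z) \<in> V"
      using \<alpha>(3) q by blast
    then show "f (p (fst z)) = H (p (fst z), r z)"
      using \<sigma>1[OF q z(2)] H(3) by (simp add: r_def)
  qed
  have V: "p q \<in> V" if "q \<in> topspace T" "\<not> 3 * \<alpha> q \<le> \<beta> q" for q
    using \<alpha>(3)[OF that(1)] \<beta>(2)[OF that(1)] that(2) by force
  show thesis
  proof (rule that[OF contG])
    show "G (q, 1) = f (p q)" if "q \<in> topspace T" for q
      using V[OF that] H(3) by (auto simp: G_def r_def)
    show "G (q, 0) \<in> B" if q: "q \<in> topspace T" "\<beta> q \<le> \<alpha> q" for q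
    proof -
      have "\<not> 3 * \<alpha> q \<le> \<beta> q"
        using pos[OF q(1)] \<beta>(2)[OF q(1)] q(2) by linarith
      then show ?thesis
        using V[OF q(1)] H(4) \<sigma>0[OF q] by (simp add: G_def r_def)
    qed
    show "G (q, t) \<in> B" if "q \<in> topspace T" "p q \<in> A" "t \<in> {0..1}" for q t
    proof -
      have "f (p q) \<in> B"
        using f that(2) by (auto simp: pair_map_def)
      moreover have "H (p q, r (q, t)) \<in> B"
        using H(2) that(2) r01[OF that(3)] by blast
      ultimately show ?thesis
        by (simp add: G_def)
    qed
  qed
qed

section \<open>Weight functions for a relative cover\<close>

text \<open>The shrinking lemma alone need not make weight 0 positive on A, as other sets may cover
  points of A too. Hence a separate Urysohn function for A inside \<open>V 0\<close> is added to
  that weight.\<close>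

lemma relcat_cover_functions:
  assumes cov: "relcat_cover X A Y B f n V" and X: "normal_space X" and A: "closedin X A"
  obtains a :: "nat \<Rightarrow> 'a \<Rightarrow> real" where
    "\<And>i. i \<le> n \<Longrightarrow> continuous_map X euclideanreal (a i)"
    "\<And>i x. i \<le> n \<Longrightarrow> x \<in> topspace X \<Longrightarrow> 0 \<le> a i x"
    "\<And>i x. i \<le> n \<Longrightarrow> x \<in> topspace X \<Longrightarrow> 0 < a i x \<Longrightarrow> x \<in> V i"
    "\<And>x. x \<in> topspace X \<Longrightarrow> \<exists>i\<le>n. 0 < a i x"
    "\<And>x. x \<in> A \<Longrightarrow> 0 < a 0 x"
proof -
  have V: "\<And>i. i \<le> n \<Longrightarrow> openin X (V i)" "(\<Union>i\<le>n. V i) = topspace X" "A \<subseteq> V 0"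
    using cov by (auto simp: relcat_cover_def)
  obtain u :: "'a \<Rightarrow> real" where u: "continuous_map X euclideanreal u"
    "\<And>x. x \<in> topspace X \<Longrightarrow> 0 \<le> u x" "\<And>x. x \<in> topspace X \<Longrightarrow> 0 < u x \<Longrightarrow> x \<in> V 0"
    "\<And>x. x \<in> A \<Longrightarrow> 0 < u x"
    using normal_space_Urysohn_open[OF X A V(1)[of 0] V(3)] by blast
  have "\<exists>a :: nat \<Rightarrow> 'a \<Rightarrow> real. (\<forall>i<Suc n. continuous_map X euclideanreal (a i) \<and>
      (\<forall>x\<in>topspace X. 0 \<le> a i x \<and> (0 < a i x \<longrightarrow> x \<in> V i))) \<and>
      (\<forall>x\<in>topspace X. \<exists>i<Suc n. 0 < a i x)"
    using V by (intro normal_space_cover_functions[OF X]) (auto simp: less_Suc_eq_le lessThan_Suc_atMost)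
  then obtain a :: "nat \<Rightarrow> 'a \<Rightarrow> real" where
    a: "\<And>i. i \<le> n \<Longrightarrow> continuous_map X euclideanreal (a i)"
      "\<And>i x. i \<le> n \<Longrightarrow> x \<in> topspace X \<Longrightarrow> 0 \<le> a i x"
      "\<And>i x. i \<le> n \<Longrightarrow> x \<in> topspace X \<Longrightarrow> 0 < a i x \<Longrightarrow> x \<in> V i"
      "\<And>x. x \<in> topspace X \<Longrightarrow> \<exists>i\<le>n. 0 < a i x"
    unfolding less_Suc_eq_le by metis
  define a' where "a' = a(0 := (\<lambda>x. a 0 x + u x))"
  have AX: "A \<subseteq> topspace X"
    using A closedin_subset by blast
  show thesis
  proof (rule that[of a'])
    show "continuous_map X euclideanreal (a' i)" if "i \<le> n" for i
      using a(1)[OF that] u(1) by (auto simp: a'_def intro: continuous_map_add)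
    show "0 \<le> a' i x" if "i \<le> n" "x \<in> topspace X" for i x
      using a(2)[OF that] u(2)[OF that(2)] by (auto simp: a'_def)
    show "x \<in> V i" if "i \<le> n" "x \<in> topspace X" "0 < a' i x" for i x
      using a(3)[OF that(1,2)] u(3)[OF that(2)] that(3)
      by (cases "i = 0") (force simp: a'_def)+
    show "\<exists>i\<le>n. 0 < a' i x" if x: "x \<in> topspace X" for x
    proof -
      obtain i where "i \<le> n" "0 < a i x"
        using a(4)[OF x] by blast
      then show ?thesis
        using u(2)[OF x] by (intro exI[of _ i]) (auto simp: a'_def)
    qed
    show "0 < a' 0 x" if "x \<in> A" for x
      using u(4)[OF that] a(2)[of 0 x] AX that by (auto simp: a'_def intro: add_nonneg_pos)
  qed
qed


section \<open>Strata of the product and their disjoint neighbourhoods\<close>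

text \<open>
  Off the set where the weight of index \<open>0\<close> of one factor is positive, the strata
  \<open>{a\<^sub>0 = \<dots> = a\<^sub>i\<^sub>-\<^sub>1 = 0 < a\<^sub>i} \<times> {b\<^sub>0 = \<dots> = b\<^sub>j\<^sub>-\<^sub>1 = 0 < b\<^sub>j}\<close> with \<open>i + j = k\<close> have disjoint open
  neighbourhoods.
\<close>

definition stratum_nbhd ::
    "('a \<times> 'c) topology \<Rightarrow> (nat \<Rightarrow> 'a \<Rightarrow> real) \<Rightarrow> (nat \<Rightarrow> 'c \<Rightarrow> real) \<Rightarrow> nat \<Rightarrow> nat \<Rightarrow> ('a \<times> 'c) set" where
  "stratum_nbhd T a b i j = {q \<in> topspace T.
     (\<Sum>l<i. a l (fst q)) + (\<Sum>l<j. b l (snd q)) < min (a i (fst q)) (b j (snd q))}"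

lemma openin_stratum_nbhd:
  assumes "\<And>l. l \<le> i \<Longrightarrow> continuous_map X euclideanreal (a l)"
    and "\<And>l. l \<le> j \<Longrightarrow> continuous_map Z euclideanreal (b l)"
  shows "openin (prod_topology X Z) (stratum_nbhd (prod_topology X Z) a b i j)"
proof -
  let ?T = "prod_topology X Z"
  have a: "continuous_map ?T euclideanreal (\<lambda>q. a l (fst q))" if "l \<le> i" for l
    using continuous_map_compose[OF continuous_map_fst assms(1)[OF that], of Z] by (simp add: o_def)
  have b: "continuous_map ?T euclideanreal (\<lambda>q. b l (snd q))" if "l \<le> j" for l
    using continuous_map_compose[OF continuous_map_snd assms(2)[OF that], of X] by (simp add: o_def)
  have "continuous_map ?T euclideanreal (\<lambda>q. min (a i (fst q)) (b j (snd q)) -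
      ((\<Sum>l<i. a l (fst q)) + (\<Sum>l<j. b l (snd q))))"
    by (intro continuous_intros a b) auto
  from openin_continuous_map_preimage[OF this, of "{0<..}"] show ?thesis
    by (simp add: stratum_nbhd_def)
qed

text \<open>A common point would give \<open>b j' < a i\<close> from the first set, where
  \<open>b j'\<close> is one of the summed terms, and \<open>a i < b j'\<close> from the second,
  where \<open>a i\<close> is one. Nonnegativity bounds a single term by its sum.\<close>

lemma stratum_nbhd_disjoint:
  assumes a: "\<And>l x. l \<le> n \<Longrightarrow> x \<in> topspace X \<Longrightarrow> 0 \<le> a l x"
    and b: "\<And>l z. l \<le> m \<Longrightarrow> z \<in> topspace Z \<Longrightarrow> 0 \<le> b l z"
    and "i \<le> n" "i' \<le> n" "j \<le> m" "j' \<le> m" "i < i'" "j' < j"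
  shows "stratum_nbhd (prod_topology X Z) a b i j \<inter> stratum_nbhd (prod_topology X Z) a b i' j' = {}"
proof (rule ccontr)
  assume "\<not> ?thesis"
  then obtain q where q: "q \<in> stratum_nbhd (prod_topology X Z) a b i j"
      "q \<in> stratum_nbhd (prod_topology X Z) a b i' j'"
    by blast
  then have x: "fst q \<in> topspace X" and z: "snd q \<in> topspace Z"
    by (auto simp: stratum_nbhd_def)
  have "b j' (snd q) \<le> (\<Sum>l<j. b l (snd q))"
    using b[OF _ z] assms by (intro member_le_sum) auto
  moreover have "0 \<le> (\<Sum>l<i. a l (fst q))"
    using a[OF _ x] assms by (intro sum_nonneg) auto
  ultimately have "b j' (snd q) < a i (fst q)"
    using q(1) by (simp add: stratum_nbhd_def)
  moreover have "a i (fst q) \<le> (\<Sum>l<i'. a l (fst q))"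
    using a[OF _ x] assms by (intro member_le_sum) auto
  moreover have "0 \<le> (\<Sum>l<j'. b l (snd q))"
    using b[OF _ z] assms by (intro sum_nonneg) auto
  ultimately show False
    using q(2) by (simp add: stratum_nbhd_def)
qed

lemma stratum_nbhd_positive:
  assumes a: "\<And>l x. l \<le> i \<Longrightarrow> x \<in> topspace X \<Longrightarrow> 0 \<le> a l x"
    and b: "\<And>l z. l \<le> j \<Longrightarrow> z \<in> topspace Z \<Longrightarrow> 0 \<le> b l z"
    and q: "q \<in> stratum_nbhd (prod_topology X Z) a b i j"
  shows "0 < a i (fst q)" "0 < b j (snd q)"
proof -
  have x: "fst q \<in> topspace X" and z: "snd q \<in> topspace Z"
    using q by (auto simp: stratum_nbhd_def)
  have "0 \<le> (\<Sum>l<i. a l (fst q))" "0 \<le> (\<Sum>l<j. b l (snd q))"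
    using a[OF _ x] b[OF _ z] by (auto intro!: sum_nonneg)
  then show "0 < a i (fst q)" "0 < b j (snd q)"
    using q by (auto simp: stratum_nbhd_def)
qed

text \<open>At the least indices with positive weight both sums vanish while the minimum is
  positive.\<close>

lemma in_stratum_nbhd_Least:
  assumes a: "\<And>l. l \<le> n \<Longrightarrow> 0 \<le> a l (fst q)" and b: "\<And>l. l \<le> m \<Longrightarrow> 0 \<le> b l (snd q)"
    and q: "q \<in> topspace T" and ex: "\<exists>i\<le>n. 0 < a i (fst q)" "\<exists>j\<le>m. 0 < b j (snd q)"
  obtains i j where "i \<le> n" "j \<le> m" "0 < a i (fst q)" "0 < b j (snd q)" "q \<in> stratum_nbhd T a b i j"
proof -
  define i where "i = (LEAST i. 0 < a i (fst q))"
  define j where "j = (LEAST j. 0 < b j (snd q))"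
  have i: "i \<le> n" "0 < a i (fst q)" "\<And>l. l < i \<Longrightarrow> \<not> 0 < a l (fst q)"
    using ex(1) unfolding i_def by (auto intro: LeastI order_trans[OF Least_le] dest: not_less_Least)
  have j: "j \<le> m" "0 < b j (snd q)" "\<And>l. l < j \<Longrightarrow> \<not> 0 < b l (snd q)"
    using ex(2) unfolding j_def by (auto intro: LeastI order_trans[OF Least_le] dest: not_less_Least)
  have "a l (fst q) = 0" if "l < i" for l
    using a[of l] i that by fastforce
  moreover have "b l (snd q) = 0" if "l < j" for l
    using b[of l] j that by fastforce
  ultimately have "q \<in> stratum_nbhd T a b i j"
    using q i j by (simp add: stratum_nbhd_def)
  then show thesis
    using that i j by blast
qed

section \<open>The relative cover of the product\<close>

lemma relcat_cover_prod:
  assumes f: "pair_map X A Y B f" and g: "pair_map Z C W D g"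
    and pf: "image_in_path_component X Y f" and pg: "image_in_path_component Z W g"
    and X: "normal_space X" and Z: "normal_space Z" and A: "closedin X A" and C: "closedin Z C"
    and x0: "x0 \<in> topspace X" and z0: "z0 \<in> topspace Z"
    and cf: "relcat_cover X A Y B f n V" and cg: "relcat_cover Z C W D g m U"
  shows "\<exists>K. relcat_cover (prod_topology X Z) (topspace X \<times> C \<union> A \<times> topspace Z)
      (prod_topology Y W) (topspace Y \<times> D \<union> B \<times> topspace W) (map_prod f g) (n + m) K"
proof -
  let ?T = "prod_topology X Z" and ?A = "topspace X \<times> C \<union> A \<times> topspace Z"
    and ?B = "topspace Y \<times> D \<union> B \<times> topspace W" and ?I = "top_of_set {0..1::real}"
  obtain a :: "nat \<Rightarrow> 'a \<Rightarrow> real" where a: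
    "\<And>i. i \<le> n \<Longrightarrow> continuous_map X euclideanreal (a i)"
    "\<And>i x. i \<le> n \<Longrightarrow> x \<in> topspace X \<Longrightarrow> 0 \<le> a i x"
    "\<And>i x. i \<le> n \<Longrightarrow> x \<in> topspace X \<Longrightarrow> 0 < a i x \<Longrightarrow> x \<in> V i"
    "\<And>x. x \<in> topspace X \<Longrightarrow> \<exists>i\<le>n. 0 < a i x"
    "\<And>x. x \<in> A \<Longrightarrow> 0 < a 0 x"
    by (rule relcat_cover_functions[OF cf X A]) (rule that)
  obtain b :: "nat \<Rightarrow> 'c \<Rightarrow> real" where b:
    "\<And>i. i \<le> m \<Longrightarrow> continuous_map Z euclideanreal (b i)"
    "\<And>i x. i \<le> m \<Longrightarrow> x \<in> topspace Z \<Longrightarrow> 0 \<le> b i x"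
    "\<And>i x. i \<le> m \<Longrightarrow> x \<in> topspace Z \<Longrightarrow> 0 < b i x \<Longrightarrow> x \<in> U i"
    "\<And>x. x \<in> topspace Z \<Longrightarrow> \<exists>i\<le>m. 0 < b i x"
    "\<And>x. x \<in> C \<Longrightarrow> 0 < b 0 x"
    by (rule relcat_cover_functions[OF cg Z C]) (rule that)
  have AX: "A \<subseteq> topspace X" and CZ: "C \<subseteq> topspace Z"
    using A C closedin_subset by auto
  define \<alpha> where "\<alpha> = (\<lambda>q::'a \<times> 'c. a 0 (fst q))"
  define \<beta> where "\<beta> = (\<lambda>q::'a \<times> 'c. b 0 (snd q))"
  have cont\<alpha>: "continuous_map ?T euclideanreal \<alpha>" and cont\<beta>: "continuous_map ?T euclideanreal \<beta>"
    using continuous_map_compose[OF continuous_map_fst a(1)[of 0], of Z]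
      continuous_map_compose[OF continuous_map_snd b(1)[of 0], of X]
    by (simp_all add: \<alpha>_def \<beta>_def o_def)
  have \<alpha>0: "0 \<le> \<alpha> q" and \<beta>0: "0 \<le> \<beta> q" if "q \<in> topspace ?T" for q
    using that a(2)[of 0] b(2)[of 0] by (auto simp: \<alpha>_def \<beta>_def)
  define N where "N = stratum_nbhd ?T a b"
  \<comment> \<open>The index pairs are (i, k - i) with both entries at least 1;
    \<open>i < k\<close> keeps the truncated subtraction from yielding 0.\<close>
  define J where "J = (\<lambda>k. {i \<in> {1..n}. i < k \<and> k - i \<le> m})"
  \<comment> \<open>Strata with an index 0 are absorbed by \<open>K 0\<close>; for the others the
    sum of the indices lies between 2 and n + m. So \<open>K 1\<close> is empty and trivially
    inessential.\<close>
  define K where "K = (\<lambda>k. if k = 0 then {q \<in> topspace ?T. 0 < \<alpha> q + \<beta> q}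
    else \<Union>i\<in>J k. N i (k - i))"
  have openN: "openin ?T (N i j)" if "i \<le> n" "j \<le> m" for i j
    unfolding N_def using that by (intro openin_stratum_nbhd a b) auto
  have open0: "openin ?T (K 0)"
    using openin_continuous_map_preimage[OF continuous_map_add[OF cont\<alpha> cont\<beta>], of "{0<..}"]
    by (simp add: K_def)
  have openK: "openin ?T (K k)" for k
  proof (cases "k = 0")
    case False
    have "openin ?T (\<Union>i\<in>J k. N i (k - i))"
      by (intro openin_Union) (auto simp: J_def intro!: openN)
    then show ?thesis
      using False by (simp add: K_def)
  qed (use open0 in simp)
  have AK: "?A \<subseteq> K 0"
  proof
    fix q assume q: "q \<in> ?A"
    then have qT: "q \<in> topspace ?T"
      using AX CZ by auto
    from q have "0 < \<alpha> q \<or> 0 < \<beta> q"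
      using a(5) b(5) by (auto simp: \<alpha>_def \<beta>_def)
    then have "0 < \<alpha> q + \<beta> q"
      using \<alpha>0[OF qT] \<beta>0[OF qT] by linarith
    with qT show "q \<in> K 0"
      by (simp add: K_def)
  qed
  have "topspace ?T \<subseteq> (\<Union>k\<le>n + m. K k)"
  proof
    fix q assume q: "q \<in> topspace ?T"
    then have x: "fst q \<in> topspace X" and z: "snd q \<in> topspace Z"
      by auto
    obtain i j where ij: "i \<le> n" "j \<le> m" "0 < a i (fst q)" "0 < b j (snd q)" "q \<in> N i j"
      unfolding N_def
      using in_stratum_nbhd_Least[of n a q m b, OF a(2)[OF _ x] b(2)[OF _ z] q a(4)[OF x] b(4)[OF z]]
      by blast
    show "q \<in> (\<Union>k\<le>n + m. K k)"
    proof (cases "i = 0 \<or> j = 0")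
      case True
      then have "0 < \<alpha> q \<or> 0 < \<beta> q"
        using ij by (auto simp: \<alpha>_def \<beta>_def)
      then have "0 < \<alpha> q + \<beta> q"
        using \<alpha>0[OF q] \<beta>0[OF q] by linarith
      then have "q \<in> K 0"
        using q by (simp add: K_def)
      then show ?thesis
        by blast
    next
      case False
      then have "i \<in> J (i + j)"
        using ij by (auto simp: J_def)
      then have "q \<in> K (i + j)"
        using False ij(5) by (auto simp: K_def intro!: bexI[of _ i])
      then show ?thesis
        using ij(1,2) by (intro UN_I[of "i + j"]) auto
    qed
  qed
  then have cover: "(\<Union>k\<le>n + m. K k) = topspace ?T"
    using openK openin_subset by blast
  have iness: "inessential (subtopology ?T (K k)) (prod_topology Y W) (map_prod f g)"
    if k: "k \<in> {1..n + m}" for k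
  proof -
    \<comment> \<open>For fixed k the pieces lie in different products
      \<open>V i \<times> U (k - i)\<close>, whose nullhomotopies may end at different constants.
      The values at \<open>x0\<close> and \<open>z0\<close> serve as the common end that pasting
      requires.\<close>
    have "homotopic_with (\<lambda>_. True) (subtopology ?T (\<Union>i\<in>J k. N i (k - i)))
        (prod_topology Y W) (map_prod f g) (\<lambda>_. (f x0, g z0))"
    proof (rule homotopic_with_const_disjoint_Union)
      fix i assume i: "i \<in> J k"
      then have i': "i \<in> {1..n}" "k - i \<in> {1..m}"
        by (auto simp: J_def)
      then show "openin ?T (N i (k - i))"
        by (intro openN) auto
      have "homotopic_with (\<lambda>_. True) (subtopology X (V i)) Y f (\<lambda>_. f x0)"
        using cf i' pf x0 by (intro inessential_homotopic_const) (auto simp: relcat_cover_def)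
      moreover have "homotopic_with (\<lambda>_. True) (subtopology Z (U (k - i))) W g (\<lambda>_. g z0)"
        using cg i' pg z0 by (intro inessential_homotopic_const) (auto simp: relcat_cover_def)
      ultimately have "homotopic_with (\<lambda>_. True)
          (prod_topology (subtopology X (V i)) (subtopology Z (U (k - i)))) (prod_topology Y W)
          (\<lambda>z. (f (fst z), g (snd z))) (\<lambda>z. (f x0, g z0))"
        by (rule homotopic_with_prod_topology) simp
      then have "homotopic_with (\<lambda>_. True) (subtopology ?T (V i \<times> U (k - i))) (prod_topology Y W)
          (map_prod f g) (\<lambda>z. (f x0, g z0))"
        by (simp add: subtopology_Times map_prod_def case_prod_unfold)
      then have "homotopic_with (\<lambda>_. True) (subtopology (subtopology ?T (V i \<times> U (k - i))) (N i (k - i)))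
          (prod_topology Y W) (map_prod f g) (\<lambda>z. (f x0, g z0))"
        by (rule homotopic_from_subtopology)
      moreover have "N i (k - i) \<subseteq> V i \<times> U (k - i)"
      proof
        fix q assume q: "q \<in> N i (k - i)"
        then have "fst q \<in> topspace X" "snd q \<in> topspace Z"
          by (auto simp: N_def stratum_nbhd_def)
        moreover have "0 < a i (fst q)" "0 < b (k - i) (snd q)"
          using stratum_nbhd_positive[of i X a "k - i" Z b q] q i' a(2) b(2) by (auto simp: N_def)
        ultimately show "q \<in> V i \<times> U (k - i)"
          using a(3)[of i "fst q"] b(3)[of "k - i" "snd q"] i' by (auto simp: mem_Times_iff)
      qed
      ultimately show "homotopic_with (\<lambda>_. True) (subtopology ?T (N i (k - i)))
          (prod_topology Y W) (map_prod f g) (\<lambda>_. (f x0, g z0))"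
        by (simp add: subtopology_subtopology Int_absorb1)
    next
      \<comment> \<open>With the sum fixed, a larger first index means a smaller second one, which
        is the situation of \<open>stratum_nbhd_disjoint\<close>.\<close>
      have *: "N i (k - i) \<inter> N j (k - j) = {}" if "i \<in> J k" "j \<in> J k" "i < j" for i j
        unfolding N_def using that
        by (intro stratum_nbhd_disjoint[where n = n and m = m] a b) (auto simp: J_def)
      show "N i (k - i) \<inter> N j (k - j) = {}" if "i \<in> J k" "j \<in> J k" "i \<noteq> j" for i j
        using *[of i j] *[of j i] that by (cases i j rule: linorder_cases) auto
    qed
    then show ?thesis
      using k by (auto simp: K_def inessential_def)
  qed
  obtain H where H: "continuous_map (prod_topology (subtopology X (V 0)) ?I) Y H"
      "H ` (A \<times> {0..1}) \<subseteq> B" "\<And>x. x \<in> V 0 \<Longrightarrow> H (x, 1) = f x" "\<And>x. x \<in> V 0 \<Longrightarrow> H (x, 0) \<in> B"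
    using cf by (auto simp: relcat_cover_def pair_map_def)
  obtain L where L: "continuous_map (prod_topology (subtopology Z (U 0)) ?I) W L"
      "L ` (C \<times> {0..1}) \<subseteq> D" "\<And>z. z \<in> U 0 \<Longrightarrow> L (z, 1) = g z" "\<And>z. z \<in> U 0 \<Longrightarrow> L (z, 0) \<in> D"
    using cg by (auto simp: relcat_cover_def pair_map_def)
  let ?S = "subtopology ?T (K 0)"
  \<comment> \<open>Positivity of the sum is recorded in both orders because the deformation lemma
    is applied twice, with the weights exchanged.\<close>
  have T0: "q \<in> topspace ?T" "0 < \<alpha> q + \<beta> q" "0 < \<beta> q + \<alpha> q" "0 \<le> \<alpha> q" "0 \<le> \<beta> q"
    if "q \<in> topspace ?S" for q
    using that \<alpha>0[of q] \<beta>0[of q] by (auto simp: K_def)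
  have c0: "continuous_map ?S euclideanreal \<alpha>" "continuous_map ?S euclideanreal \<beta>"
      "continuous_map ?S X fst" "continuous_map ?S Z snd"
    by (intro continuous_map_from_subtopology cont\<alpha> cont\<beta> continuous_map_fst continuous_map_snd)+
  have V0: "fst q \<in> V 0" if "q \<in> topspace ?S" "0 < \<alpha> q" for q
    using a(3)[of 0 "fst q"] T0(1)[OF that(1)] that(2) by (auto simp: \<alpha>_def)
  have U0: "snd q \<in> U 0" if "q \<in> topspace ?S" "0 < \<beta> q" for q
    using b(3)[of 0 "snd q"] T0(1)[OF that(1)] that(2) by (auto simp: \<beta>_def)
  obtain G where G: "continuous_map (prod_topology ?S ?I) Y G"
    "\<And>q. q \<in> topspace ?S \<Longrightarrow> G (q, 1) = f (fst q)"
    "\<And>q. q \<in> topspace ?S \<Longrightarrow> \<beta> q \<le> \<alpha> q \<Longrightarrow> G (q, 0) \<in> B"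
    "\<And>q t. q \<in> topspace ?S \<Longrightarrow> fst q \<in> A \<Longrightarrow> t \<in> {0..1} \<Longrightarrow> G (q, t) \<in> B"
    by (rule weighted_deformation[OF f H c0(3,1) T0(4) V0 c0(2) T0(5) T0(2)])
      (assumption | rule that)+
  obtain M where M: "continuous_map (prod_topology ?S ?I) W M"
    "\<And>q. q \<in> topspace ?S \<Longrightarrow> M (q, 1) = g (snd q)"
    "\<And>q. q \<in> topspace ?S \<Longrightarrow> \<alpha> q \<le> \<beta> q \<Longrightarrow> M (q, 0) \<in> D"
    "\<And>q t. q \<in> topspace ?S \<Longrightarrow> snd q \<in> C \<Longrightarrow> t \<in> {0..1} \<Longrightarrow> M (q, t) \<in> D"
    by (rule weighted_deformation[OF g L c0(4,2) T0(5) U0 c0(1) T0(4) T0(3)])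
      (assumption | rule that)+
  define R where "R = (\<lambda>z. (G z, M z))"
  have contR: "continuous_map (prod_topology ?S ?I) (prod_topology Y W) R"
    using G(1) M(1) by (simp add: R_def continuous_map_paired)
  have top0: "topspace ?S = K 0"
    using openin_subset[OF open0] by auto
  \<comment> \<open>Membership in \<open>?B\<close> asks one coordinate to lie in B or D and the
    other merely in the whole space, so both coordinates must be known to lie in their
    spaces.\<close>
  have GY: "G (q, t) \<in> topspace Y" and MW: "M (q, t) \<in> topspace W" if "q \<in> K 0" "t \<in> {0..1}" for q t
  proof -
    have "(q, t) \<in> topspace (prod_topology ?S ?I)"
      using that top0 by simp
    then show "G (q, t) \<in> topspace Y" "M (q, t) \<in> topspace W"
      using G(1) M(1) by (auto simp: continuous_map_def Pi_iff simp del: topspace_prod_topology)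
  qed
  \<comment> \<open>A coordinate starting in A or C stays in B or D at all times, whatever the other
    coordinate does.\<close>
  have "R (q, t) \<in> ?B" if "q \<in> ?A" "t \<in> {0..1}" for q t
  proof -
    have q: "q \<in> K 0" "q \<in> topspace ?S"
      using AK that(1) top0 by auto
    have "fst q \<in> A \<or> snd q \<in> C"
      using that(1) by auto
    then show ?thesis
      using G(4)[OF q(2) _ that(2)] M(4)[OF q(2) _ that(2)] GY[OF q(1) that(2)] MW[OF q(1) that(2)]
      by (auto simp: R_def)
  qed
  then have "pair_map (prod_topology ?S ?I) (?A \<times> {0..1}) (prod_topology Y W) ?B R"
    using contR unfolding pair_map_def by blast
  moreover have "R (q, 1) = map_prod f g q \<and> R (q, 0) \<in> ?B" if q: "q \<in> K 0" for q
  proof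
    have q': "q \<in> topspace ?S"
      using q top0 by simp
    show "R (q, 1) = map_prod f g q"
      using G(2)[OF q'] M(2)[OF q'] by (simp add: R_def map_prod_def case_prod_unfold)
    \<comment> \<open>The factor with the larger weight has been deformed completely; on a tie both
      have.\<close>
    show "R (q, 0) \<in> ?B"
      using G(3)[OF q'] M(3)[OF q'] GY[OF q, of 0] MW[OF q, of 0]
      by (cases "\<beta> q \<le> \<alpha> q") (auto simp: R_def)
  qed
  ultimately have "relcat_cover ?T ?A (prod_topology Y W) ?B (map_prod f g) (n + m) K"
    unfolding relcat_cover_def using openK cover AK iness by blast
  then show ?thesis
    by blast
qed

section \<open>Relative category as a minimum, and the product inequality\<close>

lemma relcat_le: "relcat_cover X A Y B f n V \<Longrightarrow> relcat X A Y B f \<le> enat n"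
  by (auto simp: relcat_def intro: Least_le)

lemma relcat_eq_enatD:
  assumes "relcat X A Y B f = enat n"
  obtains V where "relcat_cover X A Y B f n V"
proof -
  have ex: "\<exists>n V. relcat_cover X A Y B f n V"
    using assms by (auto simp: relcat_def split: if_splits)
  then have "n = (LEAST n. \<exists>V. relcat_cover X A Y B f n V)"
    using assms by (simp add: relcat_def)
  then show thesis
    using LeastI_ex[OF ex] that by blast
qed

text \<open>Empty factors are treated apart: the construction of the product cover needs the points
  \<open>x0\<close> and \<open>z0\<close>, and normality of a factor is read off a slice through a
  point of the other.\<close>

lemma relcat_empty_space:
  assumes "topspace X = {}" "A \<subseteq> topspace X"
  shows "relcat X A Y B f = 0"
proof -
  have "X = trivial_topology"
    using assms null_topspace_iff_trivial by blast
  then have "relcat_cover X A Y B f 0 (\<lambda>_. {})"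
    using assms by (auto simp: relcat_cover_def pair_map_def)
  from relcat_le[OF this] show ?thesis
    by (simp add: zero_enat_def[symmetric])
qed

theorem proposition2p6:
  fixes X :: "'a topology" and Y :: "'b topology" and Z :: "'c topology" and W :: "'d topology"
    and A :: "'a set" and B :: "'b set" and C :: "'c set" and D :: "'d set"
    and f :: "'a \<Rightarrow> 'b" and g :: "'c \<Rightarrow> 'd"
  assumes "cw_pair X A" and "cw_pair Y B" and "cw_pair Z C" and "cw_pair W D"
    and "pair_map X A Y B f" and "pair_map Z C W D g"
    and "image_in_path_component X Y f" and "image_in_path_component Z W g"
    and "normal_space (prod_topology X Z)"
  shows "relcat (prod_topology X Z) (topspace X \<times> C \<union> A \<times> topspace Z)
                (prod_topology Y W) (topspace Y \<times> D \<union> B \<times> topspace W) (map_prod f g)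
         \<le> relcat X A Y B f + relcat Z C W D g"
proof (cases "topspace X = {} \<or> topspace Z = {}")
  case True
  have "A \<subseteq> topspace X" "C \<subseteq> topspace Z"
    using assms cw_pair_closedin closedin_subset by blast+
  then show ?thesis
    using True by (subst relcat_empty_space) auto
next
  case False
  then obtain x0 z0 where x0: "x0 \<in> topspace X" and z0: "z0 \<in> topspace Z"
    by blast
  have normal: "normal_space X" "normal_space Z"
    using normal_space_prod_topology_factors[OF assms(9) assms(1,3)[THEN cw_pair_Hausdorff_space]] False
    by simp_all
  show ?thesis
  \<comment> \<open>If one summand is infinite, so is the right-hand side; only the finite case has
    content.\<close>
  proof (cases "relcat X A Y B f"; cases "relcat Z C W D g")
    fix n m assume n: "relcat X A Y B f = enat n" and m: "relcat Z C W D g = enat m"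
    obtain V U where "relcat_cover X A Y B f n V" "relcat_cover Z C W D g m U"
      using relcat_eq_enatD[OF n] relcat_eq_enatD[OF m] by metis
    then obtain K where "relcat_cover (prod_topology X Z) (topspace X \<times> C \<union> A \<times> topspace Z)
        (prod_topology Y W) (topspace Y \<times> D \<union> B \<times> topspace W) (map_prod f g) (n + m) K"
      using relcat_cover_prod[OF assms(5-8) normal cw_pair_closedin cw_pair_closedin x0 z0] assms(1,3)
      by blast
    from relcat_le[OF this] show ?thesis
      using n m by simp
  qed auto
qed

end
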